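(* Let $b_0,b_1,b_2,\dots$ be indeterminates, $B(x)=\sum_{i\ge0}b_ix^i$, and let $g(x)$ be the unique formal power series with $g(x)=1+xg(x)B(x^2g(x))$. For a positive integer $m$ and $n\ge1$ write $g_n^{(m)}=[x^n]g^m(x)$ and $p=\lfloor (n-1)/2\rfloor$. Then $$g_n^{(m)}=\sum \left(m\,|\,b_0^{m_0}b_1^{m_1}\cdots b_p^{m_p}\right)\,b_0^{m_0}b_1^{m_1}\cdots b_p^{m_p},$$ where the sum runs over all partitions of $n$ into odd parts, i.e. over all tuples $(m_0,\dots,m_p)$ of nonnegative integers with $n=\sum_{i=0}^p m_i(2i+1)$, the monomial $b_0^{m_0}\cdots b_p^{m_p}$ corresponding to the partition with $m_i$ parts equal to $2i+1$, and $\left(m\,|\,b_0^{m_0}\cdots b_p^{m_p}\right)$ is a numerical coefficient depending only on $m$ and the exponents.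
   Context: $[x^n]F(x)$ denotes the coefficient of $x^n$ in a power series $F$. The notation $\left(m\,|\,b_0^{m_0}b_1^{m_1}\cdots b_p^{m_p}\right)$ denotes the coefficient of the monomial $b_0^{m_0}\cdots b_p^{m_p}$ in the polynomial expansion of $g_n^{(m)}$ in terms of $b_0,b_1,\dots$. *)

theory Defs
  imports "HOL-Computational_Algebra.Formal_Power_Series" "HOL-Library.Poly_Mapping"
begin

text \<open>Polynomials over a commutative ring \<open>'a\<close> in the indeterminates \<open>b\<^sub>0, b\<^sub>1, \<dots>\<close>: finitely
  supported functions from monomials to coefficients, a monomial being a finitely supported
  exponent function.\<close>

type_synonym 'a bpoly = "(nat \<Rightarrow>\<^sub>0 nat) \<Rightarrow>\<^sub>0 'a"

definition b :: "nat \<Rightarrow> 'a::comm_ring_1 bpoly" where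
  "b i = Poly_Mapping.single (Poly_Mapping.single i 1) 1"

definition bconst :: "'a::comm_ring_1 \<Rightarrow> 'a bpoly" where
  "bconst a = Poly_Mapping.single 0 a"

definition bcoeff :: "'a::comm_ring_1 bpoly \<Rightarrow> (nat \<Rightarrow>\<^sub>0 nat) \<Rightarrow> 'a" where
  "bcoeff q e = Poly_Mapping.lookup q e"

definition B_series :: "'a::comm_ring_1 bpoly fps" where
  "B_series = Abs_fps b"

definition g_equation :: "'a::comm_ring_1 bpoly fps \<Rightarrow> bool" where
  "g_equation g \<longleftrightarrow> g = 1 + fps_X * g * (B_series oo (fps_X ^ 2 * g))"

definition g_series :: "'a::comm_ring_1 bpoly fps" where
  "g_series = (THE g. g_equation g)"

definition g_coeff :: "nat \<Rightarrow> nat \<Rightarrow> 'a::comm_ring_1 bpoly" where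
  "g_coeff m n = fps_nth (g_series ^ m) n"

text \<open>A tuple \<open>(m\<^sub>0, \<dots>, m\<^sub>p)\<close> is an exponent function supported in \<open>{0..p}\<close>; \<open>m\<^sub>i\<close> is the
  multiplicity of the part \<open>2i + 1\<close>.\<close>

definition odd_partitions :: "nat \<Rightarrow> nat \<Rightarrow> (nat \<Rightarrow>\<^sub>0 nat) set" where
  "odd_partitions n p =
     {e. Poly_Mapping.keys e \<subseteq> {0..p} \<and>
         n = (\<Sum>i=0..p. Poly_Mapping.lookup e i * (2 * i + 1))}"

end

theory Submission
  imports Defs
begin

text \<open>Give \<open>b\<^sub>i\<close> the weight \<open>2i + 1\<close>. The right-hand side of the equation for \<open>g\<close> is a contraction
  for the \<open>x\<close>-adic metric, so \<open>g\<close> is the limit of its iterates started at \<open>0\<close>. Call a series graded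
  if its coefficient of \<open>x\<^sup>n\<close> is homogeneous of weight \<open>n\<close>. The term
  \<open>x g b\<^sub>i (x\<^sup>2 g)\<^sup>i = b\<^sub>i x\<^bsup>2i+1\<^esup> g\<^bsup>i+1\<^esup>\<close> is graded whenever \<open>g\<close> is, so the iterates, \<open>g\<close> and
  \<open>g\<^sup>m\<close> are graded, and the monomials of weight \<open>n\<close> are the partitions of \<open>n\<close> into odd parts.\<close>

unbundle fps_syntax

section \<open>Fixed points of contractions on formal power series\<close>

text \<open>Each application of \<open>F\<close> fixes one more coefficient, so the iterates
  stabilise coefficientwise. The third conclusion transfers coefficientwise properties from the
  iterates to \<open>g\<close>.\<close>

lemma fps_contraction_fixpoint:
  fixes F :: "'a::zero fps \<Rightarrow> 'a fps"
  assumes contr: "\<And>n f h. (\<And>k. k < n \<Longrightarrow> f $ k = h $ k) \<Longrightarrow> F f $ n = F h $ n"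
  obtains g where "F g = g" "\<And>h. F h = h \<Longrightarrow> h = g" "\<And>n. \<exists>k. g $ n = (F ^^ k) 0 $ n"
proof -
  have contr_le: "F f $ j = F h $ j" if "\<And>k. k < n \<Longrightarrow> f $ k = h $ k" "j \<le> n" for n j f h
    using that by (intro contr) auto
  have iterate_stable: "(F ^^ k) 0 $ j = (F ^^ Suc k) 0 $ j" if "j < k" for j k
    using that
  proof (induction k arbitrary: j)
    case 0
    then show ?case by simp
  next
    case (Suc k)
    have "F ((F ^^ k) 0) $ j = F ((F ^^ Suc k) 0) $ j"
      using Suc.prems by (intro contr_le[where n = k] Suc.IH) auto
    then show ?case by simp
  qed
  \<comment> \<open>Coefficient \<open>n\<close> is stable only from iterate \<open>Suc n\<close>
    on.\<close>
  define g where "g = Abs_fps (\<lambda>n. (F ^^ Suc n) 0 $ n)"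
  have g_nth: "g $ j = (F ^^ k) 0 $ j" if "j < k" for j k
  proof -
    have "Suc j \<le> k" using that by simp
    then show ?thesis
    proof (induction k rule: dec_induct)
      case base
      show ?case by (simp add: g_def)
    next
      case (step k)
      then show ?case using iterate_stable[of j k] by simp
    qed
  qed
  have fix_g: "F g = g"
  proof (rule fps_ext)
    fix n
    have "F g $ n = F ((F ^^ n) 0) $ n"
      by (intro contr g_nth)
    also have "\<dots> = g $ n"
      using g_nth[of n "Suc n"] by simp
    finally show "F g $ n = g $ n" .
  qed
  show thesis
  proof
    show "F g = g" by (fact fix_g)
    show "h = g" if "F h = h" for h
    proof (rule fps_ext)
      fix n
      show "h $ n = g $ n"
      proof (induction n rule: less_induct)
        case (less n)
        then show ?case using contr[of n h g] that fix_g by simp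
      qed
    qed
    show "\<exists>k. g $ n = (F ^^ k) 0 $ n" for n
      using g_nth[of n "Suc n"] by blast
  qed
qed

lemma fps_mult_nth_cong:
  fixes f g f' g' :: "'a::semiring_1 fps"
  assumes "\<And>k. k \<le> n \<Longrightarrow> f $ k = f' $ k" "\<And>k. k \<le> n \<Longrightarrow> g $ k = g' $ k"
  shows "(f * g) $ n = (f' * g') $ n"
  unfolding fps_mult_nth using assms by (intro sum.cong refl) auto

lemma fps_power_nth_cong:
  fixes f f' :: "'a::semiring_1 fps"
  assumes "\<And>k. k \<le> n \<Longrightarrow> f $ k = f' $ k"
  shows "(f ^ i) $ n = (f' ^ i) $ n"
  using assms
proof (induction i arbitrary: n)
  case (Suc i)
  have "(f * f ^ i) $ n = (f' * f' ^ i) $ n"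
    using Suc.prems by (intro fps_mult_nth_cong Suc.IH) auto
  then show ?case by simp
qed simp

lemma fps_compose_nth_cong:
  fixes f f' h :: "'a::semiring_1 fps"
  assumes "\<And>k. k \<le> n \<Longrightarrow> f $ k = f' $ k"
  shows "(h oo f) $ n = (h oo f') $ n"
  unfolding fps_compose_nth using fps_power_nth_cong[OF assms] by simp

section \<open>Weighted homogeneous polynomials\<close>

definition odd_weight :: "(nat \<Rightarrow>\<^sub>0 nat) \<Rightarrow> nat" where
  "odd_weight e = (\<Sum>i\<in>Poly_Mapping.keys e. Poly_Mapping.lookup e i * (2 * i + 1))"

lemma odd_weight_superset:
  assumes "finite A" "Poly_Mapping.keys e \<subseteq> A"
  shows "odd_weight e = (\<Sum>i\<in>A. Poly_Mapping.lookup e i * (2 * i + 1))"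
  unfolding odd_weight_def using assms
  by (intro sum.mono_neutral_left) (auto simp: in_keys_iff)

lemma odd_weight_add: "odd_weight (d + e) = odd_weight d + odd_weight e"
proof -
  let ?A = "Poly_Mapping.keys d \<union> Poly_Mapping.keys e"
  have "Poly_Mapping.keys (d + e) \<subseteq> ?A" by (rule Poly_Mapping.keys_add)
  then show ?thesis
    by (simp add: odd_weight_superset[of ?A] lookup_add sum.distrib algebra_simps)
qed

text \<open>A part 2i + 1 that occurs is at most \<open>n\<close>, which yields the bound on
  \<open>i\<close>.\<close>

lemma odd_weight_eq_imp_mem_odd_partitions:
  assumes "odd_weight e = n"
  shows "e \<in> odd_partitions n ((n - 1) div 2)"
proof -
  have "i \<le> (n - 1) div 2" if i: "i \<in> Poly_Mapping.keys e" for i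
  proof -
    have "1 * (2 * i + 1) \<le> Poly_Mapping.lookup e i * (2 * i + 1)"
      using i by (intro mult_right_mono) (auto simp: in_keys_iff)
    also have "\<dots> \<le> n"
      unfolding assms[symmetric] odd_weight_def using i by (intro member_le_sum) auto
    finally have "2 * i \<le> n - 1" by simp
    then show ?thesis by simp
  qed
  then have "Poly_Mapping.keys e \<subseteq> {0..(n - 1) div 2}" by auto
  then show ?thesis
    using assms odd_weight_superset[of "{0..(n - 1) div 2}" e] by (simp add: odd_partitions_def)
qed

lemma odd_weight_of_odd_partition:
  assumes "e \<in> odd_partitions n p"
  shows "odd_weight e = n"
  using assms odd_weight_superset[of "{0..p}" e] by (simp add: odd_partitions_def)

text \<open>Exponents are at most the weight \<open>n\<close> and vanish outside
  \<open>{0..p}\<close>, so \<open>lookup\<close> embeds the set into a finite set of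
  functions.\<close>

lemma finite_odd_partitions: "finite (odd_partitions n p)"
proof (rule finite_imageD)
  have "Poly_Mapping.lookup e i \<le> n" if e: "e \<in> odd_partitions n p" for e i
  proof (cases "i \<in> Poly_Mapping.keys e")
    case True
    have "Poly_Mapping.lookup e i \<le> Poly_Mapping.lookup e i * (2 * i + 1)" by simp
    also have "\<dots> \<le> odd_weight e"
      unfolding odd_weight_def using True by (intro member_le_sum) auto
    finally show ?thesis using odd_weight_of_odd_partition[OF e] by simp
  qed (simp add: in_keys_iff)
  moreover have "Poly_Mapping.lookup e i = 0" if "e \<in> odd_partitions n p" "i \<notin> {0..p}" for e i
    using that by (auto simp: odd_partitions_def in_keys_iff)
  ultimately have "Poly_Mapping.lookup ` odd_partitions n p \<subseteq>
      {f. \<forall>i. (i \<in> {0..p} \<longrightarrow> f i \<in> {0..n}) \<and> (i \<notin> {0..p} \<longrightarrow> f i = 0)}"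
    by auto
  then show "finite (Poly_Mapping.lookup ` odd_partitions n p)"
    by (rule finite_subset) (intro finite_set_of_finite_funs finite_atLeastAtMost)
  show "inj_on Poly_Mapping.lookup (odd_partitions n p)"
    by (intro inj_onI poly_mapping_eqI) simp
qed

definition odd_homogeneous :: "nat \<Rightarrow> 'a::comm_ring_1 bpoly \<Rightarrow> bool" where
  "odd_homogeneous n q \<longleftrightarrow> (\<forall>e\<in>Poly_Mapping.keys q. odd_weight e = n)"

lemma odd_homogeneous_0: "odd_homogeneous n 0"
  by (simp add: odd_homogeneous_def)

lemma odd_homogeneous_1: "odd_homogeneous 0 1"
  by (simp add: odd_homogeneous_def odd_weight_def)

lemma odd_homogeneous_b: "odd_homogeneous (2 * i + 1) (b i)"
  by (simp add: odd_homogeneous_def b_def odd_weight_def)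

lemma odd_homogeneous_add:
  "odd_homogeneous n q \<Longrightarrow> odd_homogeneous n r \<Longrightarrow> odd_homogeneous n (q + r)"
  using Poly_Mapping.keys_add[of q r] by (auto simp: odd_homogeneous_def)

lemma odd_homogeneous_sum:
  "(\<And>i. i \<in> A \<Longrightarrow> odd_homogeneous n (q i)) \<Longrightarrow> odd_homogeneous n (sum q A)"
  by (induction A rule: infinite_finite_induct) (auto simp: odd_homogeneous_0 odd_homogeneous_add)

lemma odd_homogeneous_mult:
  "odd_homogeneous m q \<Longrightarrow> odd_homogeneous n r \<Longrightarrow> odd_homogeneous (m + n) (q * r)"
  unfolding odd_homogeneous_def
  by (auto simp: odd_weight_add dest!: subsetD[OF keys_mult])

lemma bconst_mult_monomial:
  fixes a :: "'a::comm_ring_1"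
  assumes "Poly_Mapping.keys e \<subseteq> {0..p}"
  shows "bconst a * (\<Prod>i=0..p. b i ^ Poly_Mapping.lookup e i) = Poly_Mapping.single e a"
proof -
  have power: "(b i :: 'a bpoly) ^ k = Poly_Mapping.single (Poly_Mapping.single i k) 1" for i k
    by (induction k) (simp_all add: b_def mult_single flip: single_add)
  have prod: "(\<Prod>i\<in>A. (b i :: 'a bpoly) ^ f i) =
      Poly_Mapping.single (\<Sum>i\<in>A. Poly_Mapping.single i (f i)) 1" if "finite A" for A f
    using that by (induction A) (simp_all add: power mult_single)
  have "(\<Sum>i=0..p. Poly_Mapping.single i (Poly_Mapping.lookup e i)) = e"
    by (rule poly_mapping_eqI)
      (use assms in \<open>auto simp: lookup_sum lookup_single when_def in_keys_iff\<close>)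
  then show ?thesis by (simp add: prod bconst_def mult_single)
qed

text \<open>Homogeneity puts the support of \<open>q\<close> inside the partitions; the remaining
  partitions contribute zero terms.\<close>

lemma odd_homogeneous_expansion:
  assumes "odd_homogeneous n q" and p: "p = (n - 1) div 2"
  shows "q = (\<Sum>e\<in>odd_partitions n p.
    bconst (bcoeff q e) * (\<Prod>i=0..p. b i ^ Poly_Mapping.lookup e i))"
proof -
  have "Poly_Mapping.keys q \<subseteq> odd_partitions n p"
    using assms odd_weight_eq_imp_mem_odd_partitions by (auto simp: odd_homogeneous_def)
  then have "q = (\<Sum>e\<in>odd_partitions n p. Poly_Mapping.single e (bcoeff q e))"
    by (intro poly_mapping_eqI)
      (auto simp: lookup_sum lookup_single when_def bcoeff_def finite_odd_partitions in_keys_iff)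
  also have "\<dots> = (\<Sum>e\<in>odd_partitions n p.
      bconst (bcoeff q e) * (\<Prod>i=0..p. b i ^ Poly_Mapping.lookup e i))"
    by (intro sum.cong refl bconst_mult_monomial[symmetric]) (simp add: odd_partitions_def)
  finally show ?thesis .
qed

section \<open>Graded power series\<close>

definition odd_graded :: "'a::comm_ring_1 bpoly fps \<Rightarrow> bool" where
  "odd_graded f \<longleftrightarrow> (\<forall>n. odd_homogeneous n (f $ n))"

lemma odd_graded_mult:
  assumes "odd_graded f" "odd_graded h"
  shows "odd_graded (f * h)"
  unfolding odd_graded_def fps_mult_nth
proof (intro allI odd_homogeneous_sum)
  fix n i :: nat
  assume "i \<in> {0..n}"
  then show "odd_homogeneous n (f $ i * h $ (n - i))"
    using odd_homogeneous_mult[of i "f $ i" "n - i" "h $ (n - i)"] assms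
    by (simp add: odd_graded_def)
qed

lemma odd_graded_1: "odd_graded 1"
  by (simp add: odd_graded_def odd_homogeneous_0 odd_homogeneous_1)

lemma odd_graded_power: "odd_graded f \<Longrightarrow> odd_graded (f ^ i)"
  by (induction i) (simp_all add: odd_graded_1 odd_graded_mult)

text \<open>The factor \<open>fps_X\<close> is essential to the grading: \<open>b i\<close> has
  weight 2i + 1, while \<open>(fps_X ^ 2 * f) ^ i\<close> shifts the degree by 2i only.\<close>

lemma odd_graded_B_series_compose:
  assumes "odd_graded f"
  shows "odd_graded (fps_X * (B_series oo (fps_X ^ 2 * f)))"
  unfolding odd_graded_def
proof
  fix n
  show "odd_homogeneous n ((fps_X * (B_series oo (fps_X ^ 2 * f))) $ n)"
  proof (cases n)
    case 0
    then show ?thesis by (simp add: odd_homogeneous_0)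
  next
    case (Suc k)
    have "odd_homogeneous n (b i * (fps_X ^ 2 * f) ^ i $ k)" for i
    proof (cases "k < 2 * i")
      \<comment> \<open>The factor \<open>fps_X ^ (2 * i)\<close> makes this coefficient
        zero.\<close>
      case True
      then show ?thesis
        by (simp add: power_mult_distrib fps_X_power_mult_nth odd_homogeneous_0 flip: power_mult)
    next
      case False
      \<comment> \<open>As 2i \<le> k, the subtraction does not truncate and the weight is k + 1 =
        n.\<close>
      have "odd_homogeneous (2 * i + 1 + (k - 2 * i)) (b i * (f ^ i) $ (k - 2 * i))"
        using odd_graded_power[OF assms]
        by (intro odd_homogeneous_mult odd_homogeneous_b) (simp add: odd_graded_def)
      with False Suc show ?thesis
        by (simp add: power_mult_distrib fps_X_power_mult_nth flip: power_mult)
    qed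
    with Suc show ?thesis
      by (simp add: fps_compose_nth B_series_def odd_homogeneous_sum)
  qed
qed

section \<open>The series \<open>g\<close>\<close>

definition g_step :: "'a::comm_ring_1 bpoly fps \<Rightarrow> 'a bpoly fps" where
  "g_step g = 1 + fps_X * g * (B_series oo (fps_X ^ 2 * g))"

lemma g_equation_iff_fixpoint: "g_equation g \<longleftrightarrow> g_step g = g"
  by (auto simp: g_equation_def g_step_def)

text \<open>The leading \<open>fps_X\<close> shifts degrees by one, so coefficient
  \<open>Suc k\<close> sees only coefficients up to \<open>k\<close> of the argument; coefficient 0
  is always 1.\<close>

lemma g_step_contraction:
  assumes "\<And>k. k < n \<Longrightarrow> f $ k = h $ k"
  shows "g_step f $ n = g_step h $ n"
proof (cases n)
  case (Suc k)
  have "(f * (B_series oo (fps_X ^ 2 * f))) $ k = (h * (B_series oo (fps_X ^ 2 * h))) $ k"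
    using assms Suc by (intro fps_mult_nth_cong fps_compose_nth_cong) auto
  with Suc show ?thesis by (simp add: g_step_def mult.assoc)
qed (simp add: g_step_def mult.assoc)

lemma odd_graded_g_step:
  assumes "odd_graded f"
  shows "odd_graded (g_step f)"
proof -
  \<comment> \<open>The factors are regrouped because only \<open>fps_X\<close> times the
    composition is known to be graded.\<close>
  have "odd_graded (f * (fps_X * (B_series oo (fps_X ^ 2 * f))))"
    using assms by (intro odd_graded_mult odd_graded_B_series_compose)
  then have "odd_graded (1 + f * (fps_X * (B_series oo (fps_X ^ 2 * f))))"
    using odd_graded_1 unfolding odd_graded_def fps_add_nth by (blast intro: odd_homogeneous_add)
  then show ?thesis by (simp add: g_step_def mult_ac)
qed

text \<open>Both claims use the same fixed point: uniqueness identifies it with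
  \<open>g_series\<close>, and each of its coefficients is one of a graded iterate.\<close>

lemma ex1_g_equation: "\<exists>!g :: 'a::comm_ring_1 bpoly fps. g_equation g"
  and odd_graded_g_series: "odd_graded (g_series :: 'a bpoly fps)"
proof -
  obtain g :: "'a bpoly fps" where g: "g_step g = g" "\<And>h. g_step h = h \<Longrightarrow> h = g"
      "\<And>n. \<exists>k. g $ n = (g_step ^^ k) 0 $ n"
    using fps_contraction_fixpoint[of g_step] g_step_contraction by blast
  show ex1: "\<exists>!g :: 'a bpoly fps. g_equation g"
    using g(1,2) by (auto simp: g_equation_iff_fixpoint)
  then have "g_series = g"
    unfolding g_series_def by (rule the1_equality) (simp add: g_equation_iff_fixpoint g(1))
  moreover have "odd_graded ((g_step ^^ k) (0 :: 'a bpoly fps))" for k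
    by (induction k) (simp_all add: odd_graded_g_step, simp add: odd_graded_def odd_homogeneous_0)
  then have "odd_graded g"
    using g(3) by (metis odd_graded_def)
  ultimately show "odd_graded (g_series :: 'a bpoly fps)" by simp
qed

theorem theorem3:
  "(\<exists>!g :: 'a::comm_ring_1 bpoly fps. g_equation g) \<and>
   (\<exists>c :: nat \<Rightarrow> (nat \<Rightarrow>\<^sub>0 nat) \<Rightarrow> 'a.
      \<forall>m n p :: nat. m \<ge> 1 \<longrightarrow> n \<ge> 1 \<longrightarrow> p = (n - 1) div 2 \<longrightarrow>
        (\<forall>e \<in> odd_partitions n p. c m e = bcoeff (g_coeff m n) e) \<and>
        g_coeff m n =
          (\<Sum>e \<in> odd_partitions n p.
             bconst (c m e) * (\<Prod>i=0..p. b i ^ Poly_Mapping.lookup e i)))"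
proof -
  \<comment> \<open>\<open>c\<close> may depend only on \<open>m\<close> and \<open>e\<close>; the index \<open>n\<close> is recovered as the weight of \<open>e\<close>.\<close>
  define c :: "nat \<Rightarrow> (nat \<Rightarrow>\<^sub>0 nat) \<Rightarrow> 'a" where
    "c m e = bcoeff (g_coeff m (odd_weight e)) e" for m e
  have c: "c m e = bcoeff (g_coeff m n) e" if "e \<in> odd_partitions n p" for m n p e
    using odd_weight_of_odd_partition[OF that] by (simp add: c_def)
  have expansion: "g_coeff m n = (\<Sum>e \<in> odd_partitions n p.
      bconst (c m e) * (\<Prod>i=0..p. b i ^ Poly_Mapping.lookup e i))"
    if p: "p = (n - 1) div 2" for m n p
  proof -
    have "odd_homogeneous n (g_coeff m n :: 'a bpoly)"
      using odd_graded_power[OF odd_graded_g_series, where 'a = 'a]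
      by (simp add: odd_graded_def g_coeff_def)
    from odd_homogeneous_expansion[OF this p] show ?thesis
      \<comment> \<open>The congruence rule supplies the membership of \<open>e\<close> that
        \<open>c\<close> requires.\<close>
      by (simp add: c cong: sum.cong)
  qed
  show ?thesis
    using ex1_g_equation c expansion by blast
qed

end
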